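(* For $\mathbf{d}=(2,2,d_2)$ with $d_2\ge2$ and $r=2$, the Euclidean closure of $\mathcal{M}_{\mathbf{d},r}$ is strictly included in $\mathcal{V}_{\mathbf{d},r}$. In the case $\mathbf{d}=(2,2,2)$, identify a pair of quadratic forms $(c^{(j)}_{11}x_1^2+c^{(j)}_{12}x_1x_2+c^{(j)}_{22}x_2^2)_{j=1,2}\in(\mathrm{Sym}_2(\mathbb{R}^2))^2$ with its coefficient matrix $$C=\begin{pmatrix}c_{11}^{(1)}&c_{12}^{(1)}&c_{22}^{(1)}\\ c_{11}^{(2)}&c_{12}^{(2)}&c_{22}^{(2)}\end{pmatrix},$$ and let $M_{i,j}(C)$ be the $2\times2$ minor of $C$ obtained by taking the determinant of the $i$-th and $j$-th columns. Then $C\in\mathcal{M}_{(2,2,2),2}$ if and only if $$M_{1,3}(C)^2\ge M_{1,2}(C)M_{2,3}(C).$$ In particular, the algebraic boundary of $\mathcal{M}_{(2,2,2),2}$ is the vanishing locus of the polynomial $M_{1,3}(C)^2-M_{1,2}(C)M_{2,3}(C)$.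
   Context: $\mathrm{Sym}_d(\mathbb{R}^n)$ denotes the real vector space of homogeneous polynomials of degree $d$ in $n$ variables. A polynomial neural network (PNN) with architecture $(\mathbf{d}=(d_0,\dots,d_L),r)$ is the map $p_{\mathbf{w}}=W_L\circ\rho_r\circ W_{L-1}\circ\cdots\circ\rho_r\circ W_1:\mathbb{R}^{d_0}\to\mathbb{R}^{d_L}$, where $W_i\in\mathbb{R}^{d_i\times d_{i-1}}$ are linear maps (weights) $\mathbf{w}=(W_1,\dots,W_L)$ and $\rho_r$ raises each coordinate to the $r$-th power. The parameter map is $\Psi_{\mathbf{d},r}:\mathbf{w}\mapsto p_{\mathbf{w}}\in(\mathrm{Sym}_{r^{L-1}}(\mathbb{R}^{d_0}))^{d_L}$. The neuromanifold $\mathcal{M}_{\mathbf{d},r}$ is the image of $\Psi_{\mathbf{d},r}$; the neurovariety $\mathcal{V}_{\mathbf{d},r}$ is its Zariski closure in $(\mathrm{Sym}_{r^{L-1}}(\mathbb{R}^{d_0}))^{d_L}$. The algebraic boundary of a set $\mathcal{M}$ is the Zariski closure of its topological boundary $\partial\mathcal{M}$.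
   Formalization: The printed "iff" fails for (x1², x1x2), where equality holds but C is not in M; the formal statement proves the inequality for the Euclidean closure of M, and that C is in M iff the inequality is strict or all three minors vanish. *)

theory Defs
  imports "HOL-Analysis.Analysis"
begin

text \<open>Over the reals a polynomial is determined by its polynomial function, so
  \<open>Sym d\<close> is the set of functions given by homogeneous polynomials of degree \<open>d\<close>
  in \<open>CARD('n)\<close> variables; \<open>a\<close> runs over the exponent vectors.\<close>

definition Sym :: "nat \<Rightarrow> (real ^ 'n::finite \<Rightarrow> real) set" where
  "Sym d = {p. \<exists>c :: ('n \<Rightarrow> nat) \<Rightarrow> real. \<forall>x.
     p x = (\<Sum>a | (\<Sum>i\<in>UNIV. a i) = d. c a * (\<Prod>i\<in>UNIV. x $ i ^ a i))}"

definition act :: "nat \<Rightarrow> real ^ 'n::finite \<Rightarrow> real ^ 'n" where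
  "act r z = (\<chi> i. (z $ i) ^ r)"

text \<open>The network of depth \<open>L = 2\<close> with architecture
  \<open>((CARD('a), CARD('b), CARD('c)), r)\<close>.\<close>

definition pnn ::
  "nat \<Rightarrow> real ^ 'a::finite ^ 'b::finite \<Rightarrow> real ^ 'b ^ 'c::finite \<Rightarrow> real ^ 'a \<Rightarrow> real ^ 'c" where
  "pnn r W1 W2 = (\<lambda>z. W2 *v z) \<circ> act r \<circ> (\<lambda>x. W1 *v x)"

text \<open>The width of the hidden layer is not visible in the type of the maps, hence the
  \<open>itself\<close> argument.\<close>

definition neuromanifold ::
  "'b::finite itself \<Rightarrow> nat \<Rightarrow> (real ^ 'a::finite \<Rightarrow> real ^ 'c::finite) set" where
  "neuromanifold _ r = {pnn r W1 W2 | (W1 :: real ^ 'a ^ 'b) (W2 :: real ^ 'b ^ 'c). True}"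

text \<open>Row \<open>j\<close> of \<open>C\<close> holds the coefficients of \<open>x\<^sub>1\<^sup>2\<close>, \<open>x\<^sub>1 x\<^sub>2\<close>, \<open>x\<^sub>2\<^sup>2\<close>
  (without a factor 2 on the mixed term) of the \<open>j\<close>-th form.\<close>

definition quad_map :: "real ^ 3 ^ 'm::finite \<Rightarrow> real ^ 2 \<Rightarrow> real ^ 'm" where
  "quad_map C x = (\<chi> j. C $ j $ 1 * (x $ 1)\<^sup>2 + C $ j $ 2 * x $ 1 * x $ 2 + C $ j $ 3 * (x $ 2)\<^sup>2)"

lemma quad_map_inj: "inj (quad_map :: real ^ 3 ^ 'm::finite \<Rightarrow> _)"
proof (rule injI)
  fix C D :: "real ^ 3 ^ 'm" assume eq: "quad_map C = quad_map D"
  have e: "quad_map C x $ j = quad_map D x $ j" for x j using eq by simp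
  have "C $ j $ i = D $ j $ i" for j i
    using e[of "vector [1,0]" j] e[of "vector [0,1]" j] e[of "vector [1,1]" j] exhaust_3[of i]
    by (auto simp: quad_map_def)
  thus "C = D" by (simp add: vec_eq_iff)
qed

lemma sum_two: "{a :: 2 \<Rightarrow> nat. (\<Sum>i\<in>UNIV. a i) = 2}
   = {(\<lambda>i. if i = 1 then 2 else 0), (\<lambda>i. 1), (\<lambda>i. if i = 1 then 0 else 2)}"
proof -
  have "a 1 = 2 \<and> a 2 = 0 \<or> a 1 = 1 \<and> a 2 = 1 \<or> a 1 = 0 \<and> a 2 = 2" if "a 1 + a 2 = 2"
    for a :: "2 \<Rightarrow> nat" using that by arith
  thus ?thesis by (auto simp: sum_2 fun_eq_iff forall_2)
qed

lemma Sym_2_iff: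
  "p \<in> (Sym 2 :: (real ^ 2 \<Rightarrow> real) set) \<longleftrightarrow>
   (\<exists>u v w. \<forall>x. p x = u * (x $ 1)\<^sup>2 + v * x $ 1 * x $ 2 + w * (x $ 2)\<^sup>2)"
proof -
  let ?a = "(\<lambda>i. if i = 1 then 2 else 0) :: 2 \<Rightarrow> nat"
  let ?b = "(\<lambda>i. 1) :: 2 \<Rightarrow> nat"
  let ?c = "(\<lambda>i. if i = 1 then 0 else 2) :: 2 \<Rightarrow> nat"
  have ne: "?a \<noteq> ?b" "?a \<noteq> ?c" "?b \<noteq> ?c" by (auto simp: fun_eq_iff split: if_splits)
  have s: "(\<Sum>a | (\<Sum>i\<in>UNIV. a i) = 2. c a * (\<Prod>i\<in>UNIV. x $ i ^ a i))
     = c ?a * (x $ 1)\<^sup>2 + c ?b * x $ 1 * x $ 2 + c ?c * (x $ 2)\<^sup>2"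
    for c and x :: "real ^ 2"
    unfolding sum_two using ne by (simp add: prod_2 UNIV_2)
  show ?thesis
  proof
    assume "p \<in> Sym 2" thus "\<exists>u v w. \<forall>x. p x = u * (x $ 1)\<^sup>2 + v * x $ 1 * x $ 2 + w * (x $ 2)\<^sup>2"
      unfolding Sym_def s by blast
  next
    assume "\<exists>u v w. \<forall>x. p x = u * (x $ 1)\<^sup>2 + v * x $ 1 * x $ 2 + w * (x $ 2)\<^sup>2"
    then obtain u v w where p: "\<And>x. p x = u * (x $ 1)\<^sup>2 + v * x $ 1 * x $ 2 + w * (x $ 2)\<^sup>2" by blast
    define c where "c = (\<lambda>a. if a = ?a then u else if a = ?b then v else w)"
    have "c ?a = u" "c ?b = v" "c ?c = w" using ne by (simp_all add: c_def)
    thus "p \<in> Sym 2" unfolding Sym_def s mem_Collect_eq by (intro exI[of _ c]) (simp add: p)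
  qed
qed

lemma quad_map_bij:
  "bij_betw quad_map UNIV {F :: real ^ 2 \<Rightarrow> real ^ 'm::finite. \<forall>j. (\<lambda>x. F x $ j) \<in> Sym 2}"
proof -
  have "F \<in> range quad_map" if F: "\<forall>j. (\<lambda>x. F x $ j) \<in> Sym 2" for F :: "real ^ 2 \<Rightarrow> real ^ 'm"
  proof -
    have "\<forall>j. \<exists>u v w. \<forall>x. F x $ j = u * (x $ 1)\<^sup>2 + v * x $ 1 * x $ 2 + w * (x $ 2)\<^sup>2"
      using F unfolding Sym_2_iff by blast
    then obtain u v w where "\<And>j x. F x $ j = u j * (x $ 1)\<^sup>2 + v j * x $ 1 * x $ 2 + w j * (x $ 2)\<^sup>2"
      by metis
    hence "F = quad_map (\<chi> j. vector [u j, v j, w j])"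
      by (simp add: quad_map_def fun_eq_iff vec_eq_iff)
    thus ?thesis by blast
  qed
  moreover have "(\<lambda>x. quad_map C x $ j) \<in> Sym 2" for C :: "real ^ 3 ^ 'm" and j
    unfolding Sym_2_iff quad_map_def by auto
  ultimately show ?thesis unfolding bij_betw_def using quad_map_inj by blast
qed

text \<open>The neuromanifold of the architecture \<open>((2, 2, CARD('m)), 2)\<close> in these coordinates, which
  also carry the Euclidean and the Zariski topology of the space of tuples of quadratic forms.\<close>

definition neuromanifold22 :: "(real ^ 3 ^ 'm::finite) set" where
  "neuromanifold22 = quad_map -` neuromanifold TYPE(2) 2"

lemma pnn_22: "pnn 2 (A :: real ^ 2 ^ 2) B =
  quad_map (\<chi> j. vector [\<Sum>k\<in>UNIV. B $ j $ k * (A $ k $ 1)\<^sup>2,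
                          \<Sum>k\<in>UNIV. B $ j $ k * (2 * A $ k $ 1 * A $ k $ 2),
                          \<Sum>k\<in>UNIV. B $ j $ k * (A $ k $ 2)\<^sup>2])"
  by (simp add: fun_eq_iff vec_eq_iff pnn_def act_def quad_map_def matrix_vector_mult_def sum_2
      power2_eq_square algebra_simps)

lemma quad_map_neuromanifold22:
  "quad_map ` neuromanifold22 = (neuromanifold TYPE(2) 2 :: (real ^ 2 \<Rightarrow> real ^ 'm::finite) set)"
proof -
  have "neuromanifold TYPE(2) 2 \<subseteq> range (quad_map :: real ^ 3 ^ 'm \<Rightarrow> _)"
    unfolding neuromanifold_def using pnn_22 by blast
  thus ?thesis unfolding neuromanifold22_def by blast
qed

definition zariski_closure :: "'a::euclidean_space set \<Rightarrow> 'a set" where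
  "zariski_closure S =
     {x. \<forall>p. real_polynomial_function p \<and> (\<forall>y\<in>S. p y = 0) \<longrightarrow> p x = 0}"

definition neurovariety22 :: "(real ^ 3 ^ 'm::finite) set" where
  "neurovariety22 = zariski_closure neuromanifold22"

definition algebraic_boundary :: "'a::euclidean_space set \<Rightarrow> 'a set" where
  "algebraic_boundary S = zariski_closure (frontier S)"

definition minor :: "3 \<Rightarrow> 3 \<Rightarrow> real ^ 3 ^ 2 \<Rightarrow> real" where
  "minor i j C = det ((\<chi> a b. if b = 1 then C $ a $ i else C $ a $ j) :: real ^ 2 ^ 2)"

text \<open>The neuromanifold itself is not closed: the pair \<open>(x\<^sub>1\<^sup>2, x\<^sub>1 x\<^sub>2)\<close> satisfies the discriminant
  inequality with equality, but it is only a limit of points of the neuromanifold.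
  So the nonstrict inequality describes the Euclidean closure.\<close>

lemma neuromanifold22_not_closed_witness:
  fixes C :: "real ^ 3 ^ 2"
  assumes C: "C = vector [vector [1, 0, 0], vector [0, 1, 0]]"
  shows "(minor 1 3 C)\<^sup>2 = minor 1 2 C * minor 2 3 C" "C \<notin> neuromanifold22"
proof -
  show "(minor 1 3 C)\<^sup>2 = minor 1 2 C * minor 2 3 C"
    by (simp add: C minor_def det_2)
  show "C \<notin> neuromanifold22"
  proof
    assume "C \<in> neuromanifold22"
    then obtain A :: "real ^ 2 ^ 2" and B :: "real ^ 2 ^ 2" where "quad_map C = pnn 2 A B"
      unfolding neuromanifold22_def neuromanifold_def by auto
    hence "C = (\<chi> j. vector [\<Sum>k\<in>UNIV. B $ j $ k * (A $ k $ 1)\<^sup>2,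
                          \<Sum>k\<in>UNIV. B $ j $ k * (2 * A $ k $ 1 * A $ k $ 2),
                          \<Sum>k\<in>UNIV. B $ j $ k * (A $ k $ 2)\<^sup>2])"
      unfolding pnn_22 by (rule injD[OF quad_map_inj])
    hence e: "C $ j $ 1 = B $ j $ 1 * (A $ 1 $ 1)\<^sup>2 + B $ j $ 2 * (A $ 2 $ 1)\<^sup>2"
      "C $ j $ 2 = B $ j $ 1 * (2 * A $ 1 $ 1 * A $ 1 $ 2) + B $ j $ 2 * (2 * A $ 2 $ 1 * A $ 2 $ 2)"
      "C $ j $ 3 = B $ j $ 1 * (A $ 1 $ 2)\<^sup>2 + B $ j $ 2 * (A $ 2 $ 2)\<^sup>2" for j
      by (simp_all add: sum_2)
    define a b c d where "a = A$1$1" "b = A$1$2" "c = A$2$1" "d = A$2$2"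
    define p q u t where "p = B$1$1" "q = B$1$2" "u = B$2$1" "t = B$2$2"
    note ds = a_b_c_d_def p_q_u_t_def
    have h: "p*a\<^sup>2 + q*c\<^sup>2 = 1" "p*b\<^sup>2 + q*d\<^sup>2 = 0" "u*b\<^sup>2 + t*d\<^sup>2 = 0"
      "u*a*b + t*c*d = 1/2" "u*a\<^sup>2 + t*c\<^sup>2 = 0"
      using e[of 1] e[of 2] by (simp_all add: C ds)
    have D: "p*t - q*u \<noteq> 0"
    proof
      assume z: "p*t - q*u = 0"
      have "(p*a\<^sup>2 + q*c\<^sup>2)*(u*a*b + t*c*d) - (p*a*b+q*c*d)*(u*a\<^sup>2 + t*c\<^sup>2) = (p*t-q*u)*(a\<^sup>2*c*d - c\<^sup>2*a*b)"
        by algebra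
      thus False using h z by simp
    qed
    have "(p*t - q*u)*b\<^sup>2 = t*(p*b\<^sup>2 + q*d\<^sup>2) - q*(u*b\<^sup>2 + t*d\<^sup>2)" by algebra
    hence "b = 0" using h D by simp
    have "(p*t - q*u)*d\<^sup>2 = p*(u*b\<^sup>2 + t*d\<^sup>2) - u*(p*b\<^sup>2 + q*d\<^sup>2)" by algebra
    hence "d = 0" using h D by simp
    show False using h \<open>b = 0\<close> \<open>d = 0\<close> by simp
  qed
qed

end

theory Submission
  imports Defs
begin

text \<open>
  A coefficient matrix lies in the neuromanifold iff its rows are combinations of the squares of two
  linear forms, i.e. \<open>C = B N\<close> where the rows of \<open>N\<close> are \<open>(a\<^sup>2, 2ab, b\<^sup>2)\<close> and \<open>(c\<^sup>2, 2cd, d\<^sup>2)\<close>.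
  By Cauchy-Binet \<open>M\<^sub>1\<^sub>3\<^sup>2 - M\<^sub>1\<^sub>2 M\<^sub>2\<^sub>3 = (det B)\<^sup>2 (ad - bc)\<^sup>4\<close>. Conversely the left-hand side is a quarter
  of the discriminant of the binary form \<open>M\<^sub>2\<^sub>3 X\<^sup>2 - 2 M\<^sub>1\<^sub>3 XY + M\<^sub>1\<^sub>2 Y\<^sup>2\<close>, whose real roots are the linear
  forms whose squares lie in the row space of \<open>C\<close>; two distinct roots give two squares spanning it.
  A nonzero tuple of minors with vanishing discriminant can be perturbed to a positive one, which
  gives the closure. The rank-two matrices with vanishing discriminant belong to the frontier, but
  multiples of a definite form do not; they are reached by
  the Zariski closure through polynomials restricted to lines.
\<close>

subsection \<open>Zariski closure\<close>

lemma real_polynomial_function_line: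
  fixes C E :: "'a::euclidean_space"
  assumes "real_polynomial_function f"
  shows "real_polynomial_function (\<lambda>t. f (C + t *\<^sub>R E))"
proof -
  have "polynomial_function (\<lambda>t. C + t *\<^sub>R E)"
    by (intro polynomial_function_add polynomial_function_const polynomial_function_bounded_linear
        bounded_linear_scaleR_left)
  from real_polynomial_function_compose[OF this assms] show ?thesis
    by (simp add: o_def)
qed

lemma real_polynomial_function_infinite_zeros:
  fixes f :: "real \<Rightarrow> real"
  assumes f: "real_polynomial_function f" and inf: "infinite {t. f t = 0}"
  shows "f s = 0"
proof -
  obtain c n where fc: "f = (\<lambda>x. \<Sum>i\<le>n. c i * x ^ i)"
    using f unfolding real_polynomial_function_iff_sum by blast
  have "\<forall>i\<le>n. c i = 0"
    using inf unfolding fc polyfun_finite_roots by blast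
  thus ?thesis by (simp add: fc)
qed

lemma zariski_closure_superset: "S \<subseteq> zariski_closure S"
  unfolding zariski_closure_def by blast

lemma zariski_closure_minimal:
  assumes "real_polynomial_function f" "\<And>x. x \<in> S \<Longrightarrow> f x = 0"
  shows "zariski_closure S \<subseteq> {x. f x = 0}"
  using assms unfolding zariski_closure_def by blast

lemma closed_zariski_closure: "closed (zariski_closure S)"
proof -
  have "zariski_closure S = (\<Inter>f\<in>{f. real_polynomial_function f \<and> (\<forall>y\<in>S. f y = 0)}. {x. f x = 0})"
    unfolding zariski_closure_def by blast
  moreover have "closed {x. f x = 0}" if "real_polynomial_function f" for f :: "'a \<Rightarrow> real"
    using that
    by (intro closed_Collect_eq continuous_on_const continuous_at_imp_continuous_on ballI
        continuous_real_polymonial_function)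
  ultimately show ?thesis by auto
qed

text \<open>Restricted to a line, a polynomial becomes univariate, so infinitely many zeros make it
  vanish along the whole line.\<close>

lemma zariski_closure_line:
  assumes inf: "infinite {t. C + t *\<^sub>R E \<in> zariski_closure S}"
  shows "C + s *\<^sub>R E \<in> zariski_closure S"
  unfolding zariski_closure_def
proof (intro CollectI allI impI)
  fix f :: "'a \<Rightarrow> real" assume f: "real_polynomial_function f \<and> (\<forall>y\<in>S. f y = 0)"
  hence "{t. C + t *\<^sub>R E \<in> zariski_closure S} \<subseteq> {t. f (C + t *\<^sub>R E) = 0}"
    unfolding zariski_closure_def by blast
  hence "infinite {t. f (C + t *\<^sub>R E) = 0}"
    using inf finite_subset by blast
  thus "f (C + s *\<^sub>R E) = 0"
    using real_polynomial_function_infinite_zeros[OF real_polynomial_function_line] f by blast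
qed

subsection \<open>Membership in the neuromanifold\<close>

definition veronese :: "real ^ 2 ^ 'k \<Rightarrow> real ^ 3 ^ 'k::finite" where
  "veronese A = (\<chi> k. vector [(A $ k $ 1)\<^sup>2, 2 * A $ k $ 1 * A $ k $ 2, (A $ k $ 2)\<^sup>2])"

lemma neuromanifold22_iff:
  fixes C :: "real ^ 3 ^ 'm::finite"
  shows "C \<in> neuromanifold22 \<longleftrightarrow> (\<exists>(A :: real ^ 2 ^ 2) B. C = B ** veronese A)"
proof -
  have "pnn 2 A B = quad_map (B ** veronese A)" for A :: "real ^ 2 ^ 2" and B :: "real ^ 2 ^ 'm"
    unfolding pnn_22
    by (rule arg_cong[of _ _ quad_map])
      (simp add: vec_eq_iff forall_3 matrix_matrix_mult_def veronese_def)
  moreover have "C \<in> neuromanifold22 \<longleftrightarrow> (\<exists>(A :: real ^ 2 ^ 2) B. quad_map C = pnn 2 A B)"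
    unfolding neuromanifold22_def neuromanifold_def by auto
  ultimately show ?thesis by (simp add: inj_eq[OF quad_map_inj])
qed

text \<open>A linear map of the outputs is absorbed into the last layer; this allows passing between
  different numbers of outputs.\<close>

lemma matrix_mult_neuromanifold22:
  assumes "C \<in> neuromanifold22"
  shows "L ** C \<in> neuromanifold22"
  using assms unfolding neuromanifold22_iff by (metis matrix_mul_assoc)

text \<open>The linear equation on row \<open>j\<close> says that the quadratic form has no mixed term in the
  coordinates \<open>ax\<^sub>1 + bx\<^sub>2\<close>, \<open>cx\<^sub>1 + dx\<^sub>2\<close>.\<close>

lemma neuromanifold22I:
  fixes C :: "real ^ 3 ^ 'm::finite"
  assumes det: "a * d - b * c \<noteq> 0"
    and orth: "\<And>j. 2 * b * d * C $ j $ 1 - (a * d + b * c) * C $ j $ 2 + 2 * a * c * C $ j $ 3 = 0"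
  shows "C \<in> neuromanifold22"
proof -
  define A :: "real ^ 2 ^ 2" where "A = vector [vector [a, b], vector [c, d]]"
  define e where "e = (a * d - b * c)\<^sup>2"
  \<comment> \<open>Values of form \<open>j\<close> at \<open>(d, -c)\<close> and
    \<open>(b, -a)\<close>: there one of the two linear forms vanishes and the other squares to
    \<open>e\<close>.\<close>
  define P where "P = (\<lambda>j. C $ j $ 1 * d\<^sup>2 - C $ j $ 2 * c * d + C $ j $ 3 * c\<^sup>2)"
  define Q where "Q = (\<lambda>j. C $ j $ 1 * b\<^sup>2 - C $ j $ 2 * a * b + C $ j $ 3 * a\<^sup>2)"
  define B :: "real ^ 2 ^ 'm" where "B = (\<chi> j. vector [P j / e, Q j / e])"
  have e: "e \<noteq> 0" using det by (simp add: e_def)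
  have "C $ j $ i = (B ** veronese A) $ j $ i" for j i
  proof -
    have "C $ j $ 1 * e = P j * a\<^sup>2 + Q j * c\<^sup>2"
      "C $ j $ 2 * e = P j * (2 * a * b) + Q j * (2 * c * d)"
      "C $ j $ 3 * e = P j * b\<^sup>2 + Q j * d\<^sup>2"
      unfolding e_def P_def Q_def using orth[of j] by algebra+
    hence "C $ j $ 1 = (P j * a\<^sup>2 + Q j * c\<^sup>2) / e"
      "C $ j $ 2 = (P j * (2 * a * b) + Q j * (2 * c * d)) / e"
      "C $ j $ 3 = (P j * b\<^sup>2 + Q j * d\<^sup>2) / e"
      using e by (simp_all add: eq_divide_eq)
    thus ?thesis using exhaust_3[of i]
      by (auto simp: matrix_matrix_mult_def sum_2 veronese_def A_def B_def add_divide_distrib)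
  qed
  hence "C = B ** veronese A" by (simp add: vec_eq_iff)
  thus ?thesis unfolding neuromanifold22_iff by blast
qed

text \<open>Encodes \<open>p X^2 - 2 q X Y + r Y^2 = k (b X - a Y) (d X - c Y)\<close>; positive
  discriminant makes the real factors non-proportional.\<close>

lemma binary_form_factor:
  fixes p q r :: real
  assumes "q\<^sup>2 > p * r"
  obtains k a b c d where "p = k * b * d" "2 * q = k * (a * d + b * c)" "r = k * a * c"
    "a * d - b * c \<noteq> 0"
proof (cases "p = 0")
  case True
  show thesis
    \<comment> \<open>Instantiation order is \<open>k\<close>, \<open>b\<close>, \<open>d\<close>,
      \<open>a\<close>, \<open>c\<close>; the factors are \<open>-Y\<close> and
      \<open>2 q X - r Y\<close>.\<close>
    by (rule that[of 1 0 "2 * q" 1 r]) (use True assms in auto)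
next
  case False
  define s where "s = sqrt (q\<^sup>2 - p * r)"
  have s: "s\<^sup>2 = q\<^sup>2 - p * r" "s > 0" using assms by (simp_all add: s_def)
  show thesis
  proof (rule that[of p 1 1 "(q + s) / p" "(q - s) / p"])
    have "p * r = (q + s) * (q - s)" using s by algebra
    hence "r = (q + s) * (q - s) / p" using False by (simp add: eq_divide_eq mult.commute)
    thus "r = p * ((q + s) / p) * ((q - s) / p)" using False by simp
    show "(q + s) / p * 1 - 1 * ((q - s) / p) \<noteq> 0" using False s by (simp add: field_simps)
  qed (use False in \<open>auto simp: field_simps\<close>)
qed

text \<open>This is the resultant of the two rows, read as quadratic forms.\<close>

definition discr :: "real ^ 3 ^ 2 \<Rightarrow> real" where
  "discr C = (minor 1 3 C)\<^sup>2 - minor 1 2 C * minor 2 3 C"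

lemma minor_eq: "minor i j C = C $ 1 $ i * C $ 2 $ j - C $ 1 $ j * C $ 2 $ i"
  by (simp add: minor_def det_2)

lemma real_polynomial_function_discr: "real_polynomial_function discr"
proof -
  have "real_polynomial_function (\<lambda>C :: real ^ 3 ^ 2. C $ k $ i)" for k i
    by (intro real_polynomial_function.intros(1)
        bounded_linear_compose[OF bounded_linear_vec_nth bounded_linear_vec_nth])
  thus ?thesis unfolding discr_def minor_eq
    by (intro real_polynomial_function_diff real_polynomial_function_power
        real_polynomial_function.intros(4))
qed

lemma continuous_on_discr: "continuous_on S discr"
  by (intro continuous_at_imp_continuous_on ballI continuous_real_polymonial_function
      real_polynomial_function_discr)

lemma discr_pos_imp_neuromanifold22:
  assumes "discr C > 0"
  shows "C \<in> neuromanifold22"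
proof -
  from assms have "(minor 1 3 C)\<^sup>2 > minor 2 3 C * minor 1 2 C"
    by (simp add: discr_def mult.commute)
  then obtain k a b c d where f: "minor 2 3 C = k * b * d" "2 * minor 1 3 C = k * (a * d + b * c)"
    "minor 1 2 C = k * a * c" and det: "a * d - b * c \<noteq> 0"
    by (rule binary_form_factor)
  have "k \<noteq> 0" using f assms by (auto simp: discr_def)
  have "2 * b * d * C $ j $ 1 - (a * d + b * c) * C $ j $ 2 + 2 * a * c * C $ j $ 3 = 0" for j
  proof -
    \<comment> \<open>Twice the cofactor expansion of a 3 by 3 determinant in which row
      \<open>j\<close> of \<open>C\<close> is repeated.\<close>
    have "2 * minor 2 3 C * C $ j $ 1 - 2 * minor 1 3 C * C $ j $ 2 + 2 * minor 1 2 C * C $ j $ 3 = 0"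
      using exhaust_2[of j] by (auto simp: minor_eq algebra_simps)
    hence "k * (2 * b * d * C $ j $ 1 - (a * d + b * c) * C $ j $ 2 + 2 * a * c * C $ j $ 3) = 0"
      unfolding f by (simp add: algebra_simps)
    thus ?thesis using \<open>k \<noteq> 0\<close> by simp
  qed
  with det show ?thesis by (rule neuromanifold22I)
qed

definition outer :: "real ^ 2 \<Rightarrow> real ^ 3 \<Rightarrow> real ^ 3 ^ 2" where
  "outer p v = (\<chi> j i. p $ j * v $ i)"

lemma minors_zero_imp_outer:
  assumes "minor 1 2 C = 0" "minor 1 3 C = 0" "minor 2 3 C = 0"
  obtains p v where "C = outer p v" "p \<noteq> 0"
proof -
  have "\<exists>p v. C = outer p v \<and> p \<noteq> 0"
  proof (cases "C $ 1 = 0")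
    case True
    hence "C = outer (vector [0, 1]) (C $ 2)"
      by (simp add: outer_def vec_eq_iff forall_2)
    moreover have "vector [0, 1] \<noteq> (0 :: real ^ 2)" by (simp add: vec_eq_iff forall_2)
    ultimately show ?thesis by blast
  next
    case False
    then obtain i where i: "C $ 1 $ i \<noteq> 0" by (auto simp: vec_eq_iff)
    have "C $ 2 $ l * C $ 1 $ i = C $ 2 $ i * C $ 1 $ l" for l
      using assms exhaust_3[of i] exhaust_3[of l] by (auto simp: minor_eq mult.commute)
    hence "C = outer (vector [1, C $ 2 $ i / C $ 1 $ i]) (C $ 1)"
      using i by (simp add: outer_def vec_eq_iff forall_2 field_simps)
    moreover have "vector [1, C $ 2 $ i / C $ 1 $ i] \<noteq> (0 :: real ^ 2)"
      by (simp add: vec_eq_iff forall_2)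
    ultimately show ?thesis by blast
  qed
  thus thesis using that by blast
qed

lemma outer_in_neuromanifold22: "outer p v \<in> neuromanifold22"
proof -
  \<comment> \<open>Complete the square in the single form \<open>v\<close>; if it is a multiple of
    \<open>x1 x2\<close>, use \<open>x1 + x2\<close> and \<open>x1 - x2\<close>. Instantiation order
    is \<open>a\<close>, \<open>d\<close>, \<open>b\<close>, \<open>c\<close>.\<close>
  consider "v $ 1 \<noteq> 0" | "v $ 3 \<noteq> 0" | "v $ 1 = 0" "v $ 3 = 0" by blast
  thus ?thesis
  proof cases
    case 1
    thus ?thesis
      by (intro neuromanifold22I[of "2 * v $ 1" 1 "v $ 2" 0]) (simp_all add: outer_def)
  next
    case 2
    thus ?thesis
      by (intro neuromanifold22I[of "v $ 2" 0 "2 * v $ 3" 1]) (simp_all add: outer_def)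
  next
    case 3
    thus ?thesis
      by (intro neuromanifold22I[of 1 "-1" 1 1]) (simp_all add: outer_def)
  qed
qed

lemma neuromanifold22_discr:
  "C \<in> neuromanifold22 \<longleftrightarrow>
     discr C > 0 \<or> (minor 1 2 C = 0 \<and> minor 1 3 C = 0 \<and> minor 2 3 C = 0)"
proof
  assume "C \<in> neuromanifold22"
  then obtain A B :: "real ^ 2 ^ 2" and N where C: "C = B ** N" and N: "N = veronese A"
    unfolding neuromanifold22_iff by blast
  have m: "minor i j C = det B * minor i j N" for i j
    unfolding C by (simp add: minor_eq det_2 matrix_matrix_mult_def sum_2 algebra_simps)
  have mA: "minor 1 2 N = 2 * A $ 1 $ 1 * A $ 2 $ 1 * det A"
    "minor 1 3 N = (A $ 1 $ 1 * A $ 2 $ 2 + A $ 1 $ 2 * A $ 2 $ 1) * det A"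
    "minor 2 3 N = 2 * A $ 1 $ 2 * A $ 2 $ 2 * det A"
    unfolding N by (simp_all add: minor_eq det_2 veronese_def power2_eq_square algebra_simps)
  have "discr C = (det B * (det A)\<^sup>2)\<^sup>2"
    unfolding discr_def m mA det_2 by algebra
  \<comment> \<open>If the square vanishes, so does \<open>det B\<close> or \<open>det A\<close>,
    and each of them divides every minor.\<close>
  moreover have "minor 1 2 C = 0 \<and> minor 1 3 C = 0 \<and> minor 2 3 C = 0" if "det B * (det A)\<^sup>2 = 0"
    using that by (auto simp: m mA)
  ultimately show "discr C > 0 \<or> (minor 1 2 C = 0 \<and> minor 1 3 C = 0 \<and> minor 2 3 C = 0)"
    by (metis zero_less_power2)
next
  assume "discr C > 0 \<or> (minor 1 2 C = 0 \<and> minor 1 3 C = 0 \<and> minor 2 3 C = 0)"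
  thus "C \<in> neuromanifold22"
    using discr_pos_imp_neuromanifold22 minors_zero_imp_outer outer_in_neuromanifold22 by metis
qed

subsection \<open>Closure\<close>

lemma line_in_closure:
  fixes C E :: "'a::real_normed_vector"
  assumes "\<And>t. t > 0 \<Longrightarrow> C + t *\<^sub>R E \<in> S"
  shows "C \<in> closure S"
proof -
  have "(\<lambda>n. C + (1 / real (Suc n)) *\<^sub>R E) \<longlonglongrightarrow> C + 0 *\<^sub>R E"
    by (intro tendsto_intros LIMSEQ_Suc[OF lim_1_over_n])
  moreover have "\<forall>n. C + (1 / real (Suc n)) *\<^sub>R E \<in> S" using assms by simp
  ultimately show ?thesis unfolding closure_sequential by auto
qed

text \<open>Adding \<open>t\<close> times the first column to the third (or conversely) changes only one factor of
  \<open>M\<^sub>1\<^sub>2 M\<^sub>2\<^sub>3\<close> and leaves \<open>M\<^sub>1\<^sub>3\<close> fixed.\<close>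

lemma closure_neuromanifold22:
  "closure (neuromanifold22 :: (real ^ 3 ^ 2) set) = {C. discr C \<ge> 0}"
proof
  have "closed {C. discr C \<ge> 0}"
    by (intro closed_Collect_le continuous_on_const continuous_on_discr)
  moreover have "neuromanifold22 \<subseteq> {C. discr C \<ge> 0}"
    by (auto simp: neuromanifold22_discr) (simp add: discr_def)
  ultimately show "closure neuromanifold22 \<subseteq> {C. discr C \<ge> 0}"
    by (rule closure_minimal[rotated])
  show "{C. discr C \<ge> 0} \<subseteq> closure neuromanifold22"
  proof
    fix C assume "C \<in> {C. discr C \<ge> 0}"
    hence C: "discr C \<ge> 0" by simp
    consider "minor 1 2 C \<noteq> 0" | "minor 2 3 C \<noteq> 0" | "minor 1 2 C = 0" "minor 2 3 C = 0"
      by blast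
    thus "C \<in> closure neuromanifold22"
    proof cases
      case 1
      define E :: "real ^ 3 ^ 2" where "E = (\<chi> j. vector [0, 0, C $ j $ 1])"
      have "discr (C + t *\<^sub>R E) = discr C + t * (minor 1 2 C)\<^sup>2" for t
        unfolding discr_def minor_eq by (simp add: E_def power2_eq_square algebra_simps)
      hence "discr (C + t *\<^sub>R E) > 0" if "t > 0" for t
        using that 1 C by (simp add: add_nonneg_pos)
      thus ?thesis using discr_pos_imp_neuromanifold22 by (blast intro: line_in_closure)
    next
      case 2
      define E :: "real ^ 3 ^ 2" where "E = (\<chi> j. vector [C $ j $ 3, 0, 0])"
      have "discr (C + t *\<^sub>R E) = discr C + t * (minor 2 3 C)\<^sup>2" for t
        unfolding discr_def minor_eq by (simp add: E_def power2_eq_square algebra_simps)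
      hence "discr (C + t *\<^sub>R E) > 0" if "t > 0" for t
        using that 2 C by (simp add: add_nonneg_pos)
      thus ?thesis using discr_pos_imp_neuromanifold22 by (blast intro: line_in_closure)
    next
      case 3
      \<comment> \<open>Here \<open>discr C\<close> is the square of \<open>minor 1 3 C\<close>:
        either it is positive or all minors vanish.\<close>
      hence "C \<in> neuromanifold22"
        unfolding neuromanifold22_discr by (auto simp: discr_def)
      thus ?thesis using closure_subset by blast
    qed
  qed
qed

text \<open>The line \<open>t \<mapsto> (x\<^sub>1\<^sup>2 + t x\<^sub>1 x\<^sub>2, t x\<^sub>1 x\<^sub>2 + x\<^sub>2\<^sup>2)\<close> has discriminant \<open>1 - t\<^sup>2\<close>, so it leaves the closure
  while staying in the neurovariety.\<close>

lemma closure_neuromanifold22_psubset: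
  assumes "CARD('m::finite) \<ge> 2"
  shows "closure (neuromanifold22 :: (real ^ 3 ^ 'm) set) \<subset> neurovariety22"
proof -
  let ?M = "neuromanifold22 :: (real ^ 3 ^ 'm) set"
  have sub: "closure ?M \<subseteq> neurovariety22"
    unfolding neurovariety22_def
    by (rule closure_minimal[OF zariski_closure_superset closed_zariski_closure])
  obtain j0 j1 :: 'm where j: "j0 \<noteq> j1"
    using assms card_2_iff' [of "UNIV :: 'm set"] card_le_Suc0_iff_eq[of "UNIV :: 'm set"] by force
  \<comment> \<open>\<open>L\<close> places two outputs at \<open>j0\<close> and \<open>j1\<close>,
    and its transpose is a left inverse, so the claim reduces to two outputs.\<close>
  define L :: "real ^ 2 ^ 'm" where
    "L = (\<chi> l k. if l = j0 \<and> k = 1 \<or> l = j1 \<and> k = 2 then 1 else 0)"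
  have LL: "transpose L ** L = mat 1"
    using j by (simp add: vec_eq_iff forall_2 matrix_matrix_mult_def transpose_def L_def mat_def
        if_distrib[of "\<lambda>x. x * _"] cong: if_cong)
  define C E :: "real ^ 3 ^ 2"
    where "C = vector [vector [1, 0, 0], vector [0, 0, 1]]"
      and "E = vector [vector [0, 1, 0], vector [0, 1, 0]]"
  have D: "discr (C + t *\<^sub>R E) = 1 - t\<^sup>2" for t
    by (simp add: discr_def minor_eq C_def E_def power2_eq_square)
  have line: "L ** (C + t *\<^sub>R E) = L ** C + t *\<^sub>R (L ** E)" for t
    by (simp add: vec_eq_iff matrix_matrix_mult_def sum.distrib sum_distrib_left algebra_simps)
  have "infinite {0 <..< 1 :: real}" by simp
  moreover have "{0 <..< 1} \<subseteq> {t. L ** C + t *\<^sub>R (L ** E) \<in> neurovariety22}"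
  proof
    fix t :: real assume "t \<in> {0 <..< 1}"
    hence "discr (C + t *\<^sub>R E) > 0" unfolding D by (simp add: power_less_one_iff abs_square_less_1)
    hence "L ** (C + t *\<^sub>R E) \<in> ?M"
      by (intro matrix_mult_neuromanifold22 discr_pos_imp_neuromanifold22)
    thus "t \<in> {t. L ** C + t *\<^sub>R (L ** E) \<in> neurovariety22}"
      unfolding line neurovariety22_def using zariski_closure_superset by blast
  qed
  ultimately have "infinite {t. L ** C + t *\<^sub>R (L ** E) \<in> neurovariety22}"
    using finite_subset by blast
  hence "L ** (C + 2 *\<^sub>R E) \<in> neurovariety22"
    unfolding line neurovariety22_def by (rule zariski_closure_line)
  moreover have "L ** (C + 2 *\<^sub>R E) \<notin> closure ?M"
  proof
    assume "L ** (C + 2 *\<^sub>R E) \<in> closure ?M"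
    moreover have "continuous_on (closure ?M) (\<lambda>X. transpose L ** X)"
      unfolding matrix_matrix_mult_def by (intro continuous_intros)
    moreover have "(\<lambda>X. transpose L ** X) ` ?M \<subseteq> closure neuromanifold22"
      using matrix_mult_neuromanifold22 closure_subset by blast
    ultimately have "transpose L ** (L ** (C + 2 *\<^sub>R E)) \<in> closure neuromanifold22"
      using image_closure_subset[OF _ closed_closure] by blast
    hence "discr (C + 2 *\<^sub>R E) \<ge> 0"
      by (simp add: matrix_mul_assoc LL closure_neuromanifold22)
    thus False unfolding D by simp
  qed
  ultimately show ?thesis using sub by blast
qed

subsection \<open>Algebraic boundary\<close>

lemma frontier_neuromanifold22_subset:
  "frontier (neuromanifold22 :: (real ^ 3 ^ 2) set) \<subseteq> {C. discr C = 0}"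
proof -
  have "open {C. discr C > 0}"
    by (intro open_Collect_less continuous_on_const continuous_on_discr)
  hence "{C. discr C > 0} \<subseteq> interior neuromanifold22"
    by (intro interior_maximal) (auto intro: discr_pos_imp_neuromanifold22)
  thus ?thesis unfolding frontier_def closure_neuromanifold22 by force
qed

text \<open>Such a matrix is a limit of the neuromanifold but lies outside it, since vanishing
  discriminant is attained there only at rank at most one.\<close>

lemma frontier_neuromanifold22I:
  assumes "discr C = 0" "minor 1 2 C \<noteq> 0 \<or> minor 1 3 C \<noteq> 0 \<or> minor 2 3 C \<noteq> 0"
  shows "C \<in> frontier neuromanifold22"
proof -
  have "C \<in> closure neuromanifold22" using assms by (simp add: closure_neuromanifold22)
  moreover have "C \<notin> neuromanifold22" using assms by (auto simp: neuromanifold22_discr)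
  ultimately show ?thesis unfolding frontier_def using interior_subset by blast
qed

text \<open>An indefinite form \<open>v\<close> has two distinct real linear factors; with \<open>w\<close> the square of one of them,
  the span of \<open>v\<close> and \<open>w\<close> is tangent to the cone of squares.\<close>

lemma outer_indefinite_in_algebraic_boundary:
  assumes p: "p \<noteq> 0" and v: "(v $ 2)\<^sup>2 > 4 * v $ 1 * v $ 3"
  shows "outer p v \<in> algebraic_boundary neuromanifold22"
proof -
  from v have "(v $ 2 / 2)\<^sup>2 > v $ 1 * v $ 3" by (simp add: power_divide)
  then obtain k a b c d where f: "v $ 1 = k * b * d" "2 * (v $ 2 / 2) = k * (a * d + b * c)"
    "v $ 3 = k * a * c" and det: "a * d - b * c \<noteq> 0"
    by (rule binary_form_factor)
  have v2: "v $ 2 = k * (a * d + b * c)" using f(2) by simp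
  have "k \<noteq> 0" using v f v2 by auto
  define w :: "real ^ 3" where "w = vector [b\<^sup>2, 2 * a * b, a\<^sup>2]"
  \<comment> \<open>\<open>p\<close> rotated by a right angle, so that \<open>n\<close> is the
    determinant of \<open>p\<close> and \<open>q\<close> and is nonzero.\<close>
  define q :: "real ^ 2" where "q = vector [- p $ 2, p $ 1]"
  define n where "n = (p $ 1)\<^sup>2 + (p $ 2)\<^sup>2"
  have "n \<noteq> 0" using p unfolding n_def by (auto simp: vec_eq_iff forall_2 add_nonneg_eq_0_iff)
  have m: "minor i j (outer p v + t *\<^sub>R outer q w) = t * n * (v $ i * w $ j - v $ j * w $ i)" for i j t
    by (simp add: minor_eq outer_def q_def n_def power2_eq_square algebra_simps)
  \<comment> \<open>The minors are proportional to \<open>(b^2, a b, a^2)\<close>, which forces zero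
    discriminant.\<close>
  have mw: "v $ 1 * w $ 2 - v $ 2 * w $ 1 = k * (a * d - b * c) * b\<^sup>2"
    "v $ 1 * w $ 3 - v $ 3 * w $ 1 = k * (a * d - b * c) * (a * b)"
    "v $ 2 * w $ 3 - v $ 3 * w $ 2 = k * (a * d - b * c) * a\<^sup>2"
    by (simp_all add: w_def f v2 power2_eq_square algebra_simps)
  have "outer p v + t *\<^sub>R outer q w \<in> frontier neuromanifold22" if "t > 0" for t
  proof (rule frontier_neuromanifold22I)
    show "discr (outer p v + t *\<^sub>R outer q w) = 0"
      unfolding discr_def m mw by (simp add: power2_eq_square)
    have "a \<noteq> 0 \<or> b \<noteq> 0" using det by auto
    thus "minor 1 2 (outer p v + t *\<^sub>R outer q w) \<noteq> 0 \<or> minor 1 3 (outer p v + t *\<^sub>R outer q w) \<noteq> 0 \<or>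
        minor 2 3 (outer p v + t *\<^sub>R outer q w) \<noteq> 0"
      unfolding m mw using \<open>t > 0\<close> \<open>n \<noteq> 0\<close> \<open>k \<noteq> 0\<close> det by auto
  qed
  hence "outer p v \<in> closure (frontier neuromanifold22)" by (rule line_in_closure)
  thus ?thesis unfolding algebraic_boundary_def
    using closure_minimal[OF zariski_closure_superset closed_zariski_closure] by blast
qed

text \<open>Adding a large multiple of \<open>x1 x2\<close> makes any form indefinite; vanishing on
  that ray propagates back along the line to \<open>t = 0\<close>.\<close>

lemma outer_in_algebraic_boundary:
  assumes "p \<noteq> 0"
  shows "outer p v \<in> algebraic_boundary neuromanifold22"
proof -
  define e :: "real ^ 3" where "e = vector [0, 1, 0]"
  define s where "s = 1 + \<bar>4 * v $ 1 * v $ 3\<bar> + \<bar>v $ 2\<bar>"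
  have line: "outer p v + t *\<^sub>R outer p e = outer p (v + t *\<^sub>R e)" for t
    by (simp add: outer_def vec_eq_iff algebra_simps)
  have "{s<..} \<subseteq> {t. outer p v + t *\<^sub>R outer p e \<in> algebraic_boundary neuromanifold22}"
  proof
    fix t assume "t \<in> {s<..}"
    hence t: "v $ 2 + t > 1 + \<bar>4 * v $ 1 * v $ 3\<bar>" by (simp add: s_def)
    hence "v $ 2 + t \<le> (v $ 2 + t)\<^sup>2" by (intro self_le_power) auto
    with t have "((v + t *\<^sub>R e) $ 2)\<^sup>2 > 4 * (v + t *\<^sub>R e) $ 1 * (v + t *\<^sub>R e) $ 3"
      by (simp add: e_def)
    thus "t \<in> {t. outer p v + t *\<^sub>R outer p e \<in> algebraic_boundary neuromanifold22}"
      unfolding line mem_Collect_eq by (rule outer_indefinite_in_algebraic_boundary[OF assms])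
  qed
  hence "infinite {t. outer p v + t *\<^sub>R outer p e \<in> algebraic_boundary neuromanifold22}"
    using infinite_Ioi finite_subset by blast
  hence "outer p v + 0 *\<^sub>R outer p e \<in> algebraic_boundary neuromanifold22"
    unfolding algebraic_boundary_def by (rule zariski_closure_line)
  thus ?thesis by simp
qed

lemma algebraic_boundary_neuromanifold22:
  "algebraic_boundary (neuromanifold22 :: (real ^ 3 ^ 2) set) = {C. discr C = 0}"
proof
  show "algebraic_boundary neuromanifold22 \<subseteq> {C. discr C = 0}"
    unfolding algebraic_boundary_def
    by (rule zariski_closure_minimal[OF real_polynomial_function_discr])
      (use frontier_neuromanifold22_subset in blast)
  show "{C. discr C = 0} \<subseteq> algebraic_boundary neuromanifold22"
  proof
    fix C assume "C \<in> {C. discr C = 0}"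
    hence C: "discr C = 0" by simp
    show "C \<in> algebraic_boundary neuromanifold22"
    proof (cases "minor 1 2 C = 0 \<and> minor 1 3 C = 0 \<and> minor 2 3 C = 0")
      case True
      then obtain p v where "C = outer p v" "p \<noteq> 0" using minors_zero_imp_outer by blast
      thus ?thesis using outer_in_algebraic_boundary by simp
    next
      case False
      hence "C \<in> frontier neuromanifold22" using C by (intro frontier_neuromanifold22I) auto
      thus ?thesis unfolding algebraic_boundary_def using zariski_closure_superset by blast
    qed
  qed
qed

theorem proposition4p2:
  shows "(CARD('m::finite) \<ge> 2 \<longrightarrow>
            closure (neuromanifold22 :: (real ^ 3 ^ 'm) set) \<subset> neurovariety22) \<and>
         (\<forall>C :: real ^ 3 ^ 2.
            C \<in> closure neuromanifold22 \<longleftrightarrow>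
              (minor 1 3 C)\<^sup>2 \<ge> minor 1 2 C * minor 2 3 C) \<and>
         (\<forall>C :: real ^ 3 ^ 2.
            C \<in> neuromanifold22 \<longleftrightarrow>
              (minor 1 3 C)\<^sup>2 > minor 1 2 C * minor 2 3 C \<or>
              (minor 1 2 C = 0 \<and> minor 1 3 C = 0 \<and> minor 2 3 C = 0)) \<and>
         algebraic_boundary (neuromanifold22 :: (real ^ 3 ^ 2) set) =
           {C. (minor 1 3 C)\<^sup>2 - minor 1 2 C * minor 2 3 C = 0}"
  using closure_neuromanifold22_psubset[where 'm='m]
  by (auto simp: closure_neuromanifold22 neuromanifold22_discr algebraic_boundary_neuromanifold22
      discr_def)

end
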